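(* Let $G$ and $H$ be graphs of order $n$ and $m$, respectively. Then $$\gamma_{rdR}(G\times H)\ge\left\lceil\frac{3nm}{\Delta(G)\Delta(H)+1}\right\rceil.$$ In particular, if $G\times H$ is connected, then $$\gamma_{rdR}(G\times H)\le 2nm-2.$$
   Context: Graphs are simple. The order of a graph is its number of vertices and $\Delta(G)$ is the maximum degree of $G$. A restrained double Roman dominating function (RDRD-function) of a graph $G$ is a function $f:V(G)\to\{0,1,2,3\}$ such that: (i) if $f(v)=0$, then $v$ has at least two neighbours assigned 2 under $f$ or one neighbour $u$ with $f(u)=3$; (ii) if $f(v)=1$, then $v$ has a neighbour $u$ with $f(u)\ge 2$; (iii) the subgraph of $G$ induced by the vertices assigned 0 under $f$ contains no isolated vertex. The weight of $f$ is $\sum_{v\in V(G)}f(v)$, and $\gamma_{rdR}(G)$ is the minimum weight of an RDRD-function of $G$. The cardinal (direct) product $G\times H$ has vertex set $V(G)\times V(H)$, with $(u,v)(u',v')$ an edge if $uu'\in E(G)$ and $vv'\in E(H)$.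
   Formalization: Both G and H are assumed to have at least one edge; otherwise, for nonempty graphs, G×H is edgeless, its restrained double Roman domination number is 2nm, and the claimed lower bound 3nm fails (for K1×K1 the upper bound 0 fails as well). *)

theory Defs
  imports Complex_Main "Graph_Theory.Graph_Theory"
begin

text \<open>
  A finite simple graph is a \<^locale>\<open>pair_graph\<close>: finite, loop-free, without parallel arcs, and
  symmetric.  An edge is thus present as two opposite arcs, so the (undirected) degree of a
  vertex is its \<^const>\<open>out_degree\<close> and its neighbours are the heads of its outgoing arcs.
\<close>

definition neighbours :: "'a pair_pre_digraph \<Rightarrow> 'a \<Rightarrow> 'a set" where
  "neighbours G v = {u. (v, u) \<in> parcs G}"

text \<open>Only meaningful for finite graphs with at least one vertex.\<close>

definition max_degree :: "'a pair_pre_digraph \<Rightarrow> nat" where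
  "max_degree G = Max (out_degree G ` pverts G)"

definition isolated_vertex :: "('a, 'b) pre_digraph \<Rightarrow> 'a \<Rightarrow> bool" where
  "isolated_vertex G v \<longleftrightarrow> v \<in> verts G \<and> out_degree G v = 0"

definition cardinal_product ::
    "'a pair_pre_digraph \<Rightarrow> 'b pair_pre_digraph \<Rightarrow> ('a \<times> 'b) pair_pre_digraph" where
  "cardinal_product G H =
     \<lparr> pverts = pverts G \<times> pverts H,
       parcs = {((u, v), (u', v')) | u v u' v'. (u, u') \<in> parcs G \<and> (v, v') \<in> parcs H} \<rparr>"

text \<open>Values of \<open>f\<close> outside the vertex set are irrelevant, here and for the weight.\<close>

definition RDRD_function :: "'a pair_pre_digraph \<Rightarrow> ('a \<Rightarrow> nat) \<Rightarrow> bool" where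
  "RDRD_function G f \<longleftrightarrow>
     f ` pverts G \<subseteq> {0, 1, 2, 3} \<and>
     (\<forall>v \<in> pverts G. f v = 0 \<longrightarrow>
        card {u \<in> neighbours G v. f u = 2} \<ge> 2 \<or> (\<exists>u \<in> neighbours G v. f u = 3)) \<and>
     (\<forall>v \<in> pverts G. f v = 1 \<longrightarrow> (\<exists>u \<in> neighbours G v. f u \<ge> 2)) \<and>
     \<not> (\<exists>v. isolated_vertex (with_proj G \<restriction> {v \<in> pverts G. f v = 0}) v)"

definition weight :: "'a pair_pre_digraph \<Rightarrow> ('a \<Rightarrow> nat) \<Rightarrow> nat" where
  "weight G f = (\<Sum>v \<in> pverts G. f v)"

text \<open>The minimum exists: the constant function 2 is always an RDRD-function.\<close>

definition \<gamma>_rdR :: "'a pair_pre_digraph \<Rightarrow> nat" where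
  "\<gamma>_rdR G = (LEAST w. \<exists>f. RDRD_function G f \<and> weight G f = w)"

end

theory Submission
  imports Defs
begin

text \<open>
  Neither bound uses much of the product structure.  The product of two simple graphs is a simple
  graph of order \<open>n * m\<close>, and its vertex degrees are products of degrees, hence at most
  \<open>D = \<Delta>(G) * \<Delta>(H)\<close>; since both factors have an edge, \<open>D \<ge> 1\<close> and
  \<open>n * m \<ge> 4\<close>.  So it suffices to treat a single graph with \<open>N\<close> vertices.

  \<^bold>\<open>Lower bound\<close> (\<open>RDRD_weight_lower_bound\<close>): \<open>3 * N \<le> (D + 1) * w\<close> for the weight \<open>w\<close> of every
  RDRD-function of a graph with all degrees at most \<open>D\<close>.  This is double counting.  Let every
  vertex send a fixed amount to each of its neighbours; in total at most \<open>D\<close> times the sum of these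
  amounts is sent (\<open>demand_le_degree_times_supply\<close>).  If \<open>D \<ge> 2\<close>, a vertex of value 3 sends 2 and a
  vertex of value 2 sends 1, so that every vertex of value 0 receives at least 2, and comparing
  the cost of sending with the weight value by value gives the bound.  If \<open>D = 1\<close> this comparison
  fails for the values 1 and 2, but then there are no vertices of value 0: such a vertex needs a
  neighbour of value 0 besides the neighbours that dominate it
  (\<open>RDRD_zero_imp_two_neighbours\<close>).  It remains to see that the
  vertices of value 1 do not outnumber those of value at least 2, which is the same double counting
  with the roles changed.

  \<^bold>\<open>Upper bound\<close> (\<open>connected_rdR_upper_bound\<close>): a connected graph on at least three vertices has a
  vertex with two distinct neighbours.  Give these two neighbours the value 1 and all other vertices
  the value 2.  The restraint condition is vacuous because the value 0 is not used.
\<close>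

section \<open>Functions avoiding the value 0\<close>

text \<open>
  Only the condition on vertices of value 1 survives: nothing has to be dominated twice, and the
  graph induced by the value 0 is empty.
\<close>

lemma RDRD_function_without_zero:
  assumes range: "\<And>v. v \<in> pverts G \<Longrightarrow> f v \<in> {1, 2, 3}"
    and one: "\<And>v. v \<in> pverts G \<Longrightarrow> f v = 1 \<Longrightarrow> \<exists>u \<in> neighbours G v. 2 \<le> f u"
  shows "RDRD_function G f"
proof -
  have pos: "f v \<noteq> 0" if "v \<in> pverts G" for v
    using range[OF that] by auto
  have "\<not> isolated_vertex (with_proj G \<restriction> {v \<in> pverts G. f v = 0}) v" for v
    using pos by (simp add: isolated_vertex_def)
  moreover have "f ` pverts G \<subseteq> {0, 1, 2, 3}"
    using range by blast
  ultimately show ?thesis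
    using pos one unfolding RDRD_function_def by fastforce
qed

section \<open>Neighbourhoods and degrees\<close>

lemma out_degree_eq_card_neighbours:
  "out_degree (with_proj G) v = card (neighbours G v)"
proof -
  have "out_arcs (with_proj G) v = Pair v ` neighbours G v"
    by (auto simp: out_arcs_def neighbours_def)
  then show ?thesis
    by (simp add: out_degree_def card_image inj_on_def)
qed

context pair_graph
begin

lemma neighbours_subset: "neighbours G v \<subseteq> pverts G"
  by (auto simp: neighbours_def dest: in_arcsD2)

lemma finite_neighbours: "finite (neighbours G v)"
  using neighbours_subset pair_finite_verts by (rule finite_subset)

lemma neighbours_sym: "u \<in> neighbours G v \<longleftrightarrow> v \<in> neighbours G u"
  by (auto simp: neighbours_def intro: arcs_symmetric)

lemma card_neighbours_le_max_degree:
  assumes "v \<in> pverts G"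
  shows "card (neighbours G v) \<le> max_degree G"
  unfolding max_degree_def out_degree_eq_card_neighbours[symmetric]
  using assms pair_finite_verts by simp

lemma max_degree_pos:
  assumes "parcs G \<noteq> {}"
  shows "1 \<le> max_degree G"
proof -
  obtain a b where ab: "(a, b) \<in> parcs G"
    using assms by auto
  then have "0 < card (neighbours G a)"
    using finite_neighbours by (auto simp: card_gt_0_iff neighbours_def)
  also have "\<dots> \<le> max_degree G"
    using ab by (intro card_neighbours_le_max_degree in_arcsD1)
  finally show ?thesis by simp
qed

lemma two_le_card_verts:
  assumes "parcs G \<noteq> {}"
  shows "2 \<le> card (pverts G)"
proof -
  obtain a b where ab: "(a, b) \<in> parcs G"
    using assms by auto
  then have "{a, b} \<subseteq> pverts G" "a \<noteq> b"
    by (auto dest: in_arcsD1 in_arcsD2 no_loops')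
  then show ?thesis
    using card_mono[OF pair_finite_verts, of "{a, b}"] by simp
qed

text \<open>
  Each vertex \<open>u\<close> sends \<open>c u\<close> along every edge at it, and \<open>r v\<close> is what \<open>v\<close> has to receive.  Summing
  the transfers by sender instead of by receiver counts \<open>c u\<close> once per neighbour of \<open>u\<close>.
\<close>

lemma demand_le_degree_times_supply:
  fixes r c :: "'a \<Rightarrow> nat"
  assumes deg: "\<And>v. v \<in> pverts G \<Longrightarrow> card (neighbours G v) \<le> D"
    and demand: "\<And>v. v \<in> pverts G \<Longrightarrow> r v \<le> (\<Sum>u\<in>neighbours G v. c u)"
  shows "(\<Sum>v\<in>pverts G. r v) \<le> D * (\<Sum>v\<in>pverts G. c v)"
proof -
  have senders: "{u \<in> pverts G. u \<in> neighbours G v} = neighbours G v" for v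
    using neighbours_subset by auto
  have receivers: "{v \<in> pverts G. u \<in> neighbours G v} = neighbours G u" for u
    using neighbours_subset neighbours_sym by blast
  have "(\<Sum>v\<in>pverts G. r v) \<le> (\<Sum>v\<in>pverts G. \<Sum>u\<in>neighbours G v. c u)"
    using demand by (rule sum_mono)
  also have "\<dots> = (\<Sum>v\<in>pverts G. \<Sum>u | u \<in> pverts G \<and> u \<in> neighbours G v. c u)"
    by (simp add: senders)
  also have "\<dots> = (\<Sum>u\<in>pverts G. \<Sum>v | v \<in> pverts G \<and> u \<in> neighbours G v. c u)"
    by (rule sum.swap_restrict[OF pair_finite_verts pair_finite_verts])
  also have "\<dots> = (\<Sum>u\<in>pverts G. card (neighbours G u) * c u)"
    by (simp add: receivers)
  also have "\<dots> \<le> (\<Sum>u\<in>pverts G. D * c u)"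
    using deg by (intro sum_mono mult_right_mono) auto
  finally show ?thesis
    by (simp add: sum_distrib_left)
qed

section \<open>The lower bound\<close>

text \<open>
  By the restraint condition a vertex of value 0 has a neighbour of value 0, which does not help to
  dominate it.
\<close>

lemma RDRD_zero_imp_two_neighbours:
  assumes f: "RDRD_function G f" and v: "v \<in> pverts G" "f v = 0"
  shows "2 \<le> card (neighbours G v)"
proof -
  let ?Z = "{v \<in> pverts G. f v = 0}"
  have "\<not> isolated_vertex (with_proj G \<restriction> ?Z) v"
    using f by (auto simp: RDRD_function_def)
  then have "out_arcs (with_proj G \<restriction> ?Z) v \<noteq> {}"
    using v by (auto simp: isolated_vertex_def out_degree_def)
  then obtain z where z: "z \<in> neighbours G v" "f z = 0"
    by (auto simp: out_arcs_def neighbours_def)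
  consider (two) "2 \<le> card {u \<in> neighbours G v. f u = 2}"
    | (three) u where "u \<in> neighbours G v" "f u = 3"
    using f v by (auto simp: RDRD_function_def)
  then show ?thesis
  proof cases
    case two
    also have "card {u \<in> neighbours G v. f u = 2} \<le> card (neighbours G v)"
      using finite_neighbours by (intro card_mono) auto
    finally show ?thesis .
  next
    case three
    then have "card {z, u} \<le> card (neighbours G v)"
      using z by (intro card_mono finite_neighbours) auto
    moreover have "z \<noteq> u"
      using z three by auto
    ultimately show ?thesis
      by simp
  qed
qed

lemma RDRD_weight_lower_bound:
  assumes f: "RDRD_function G f"
    and deg: "\<And>v. v \<in> pverts G \<Longrightarrow> card (neighbours G v) \<le> D"
    and D: "1 \<le> D"
  shows "3 * card (pverts G) \<le> (D + 1) * weight G f"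
proof (cases "2 \<le> D")
  case True
  define c where "c x = (if f x = 3 then 2 else if f x = 2 then 1 else 0 :: nat)" for x
  define r where "r x = (if f x = 0 then 2 else 0 :: nat)" for x
  have transfer: "(\<Sum>v\<in>pverts G. r v) \<le> D * (\<Sum>v\<in>pverts G. c v)"
  proof (rule demand_le_degree_times_supply[OF deg])
    fix v assume v: "v \<in> pverts G"
    show "r v \<le> (\<Sum>u\<in>neighbours G v. c u)"
    proof (cases "f v = 0")
      case True
      then consider (two) "2 \<le> card {u \<in> neighbours G v. f u = 2}"
        | (three) u where "u \<in> neighbours G v" "f u = 3"
        using f v by (auto simp: RDRD_function_def)
      then have "2 \<le> (\<Sum>u\<in>neighbours G v. c u)"
      proof cases
        case two
        also have "card {u \<in> neighbours G v. f u = 2} = (\<Sum>u | u \<in> neighbours G v \<and> f u = 2. c u)"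
          by (simp add: c_def)
        also have "\<dots> \<le> (\<Sum>u\<in>neighbours G v. c u)"
          using finite_neighbours by (intro sum_mono2) auto
        finally show ?thesis .
      next
        case three
        then have "2 = c u" by (simp add: c_def)
        also have "\<dots> \<le> (\<Sum>u\<in>neighbours G v. c u)"
          using three finite_neighbours by (intro member_le_sum) auto
        finally show ?thesis .
      qed
      then show ?thesis using True by (simp add: r_def)
    qed (simp add: r_def)
  qed
  \<comment> \<open>Equality holds for the values 0 and 3; the values 1 and 2 are where \<open>D \<ge> 2\<close> enters.\<close>
  have cost: "6 + 3 * D * c v \<le> 2 * (D + 1) * f v + 3 * r v" if "v \<in> pverts G" for v
  proof -
    have "f v \<in> {0, 1, 2, 3}"
      using f that by (auto simp: RDRD_function_def)
    then show ?thesis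
      using \<open>2 \<le> D\<close> by (auto simp: c_def r_def algebra_simps)
  qed
  have "6 * card (pverts G) + 3 * (D * (\<Sum>v\<in>pverts G. c v)) = (\<Sum>v\<in>pverts G. 6 + 3 * D * c v)"
    by (simp add: sum.distrib sum_distrib_left mult.assoc)
  also have "\<dots> \<le> (\<Sum>v\<in>pverts G. 2 * (D + 1) * f v + 3 * r v)"
    using cost by (rule sum_mono)
  also have "\<dots> = 2 * ((D + 1) * weight G f) + 3 * (\<Sum>v\<in>pverts G. r v)"
    by (simp add: weight_def sum.distrib sum_distrib_left mult.assoc)
  finally show ?thesis
    using transfer by linarith
next
  case False
  then have "D = 1" using D by simp
  define c where "c x = (if 2 \<le> f x then 1 else 0 :: nat)" for x
  define r where "r x = (if f x = 1 then 1 else 0 :: nat)" for x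
  have transfer: "(\<Sum>v\<in>pverts G. r v) \<le> D * (\<Sum>v\<in>pverts G. c v)"
  proof (rule demand_le_degree_times_supply[OF deg])
    fix v assume v: "v \<in> pverts G"
    show "r v \<le> (\<Sum>u\<in>neighbours G v. c u)"
    proof (cases "f v = 1")
      case True
      then obtain u where u: "u \<in> neighbours G v" "2 \<le> f u"
        using f v by (auto simp: RDRD_function_def)
      then have "1 = c u" by (simp add: c_def)
      also have "\<dots> \<le> (\<Sum>u\<in>neighbours G v. c u)"
        using u finite_neighbours by (intro member_le_sum) auto
      finally show ?thesis using True by (simp add: r_def)
    qed (simp add: r_def)
  qed
  have cost: "3 + c v \<le> 2 * f v + r v" if "v \<in> pverts G" for v
  proof -
    have "f v \<noteq> 0"
      using RDRD_zero_imp_two_neighbours[OF f that] deg[OF that] \<open>D = 1\<close> by auto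
    then show ?thesis by (auto simp: c_def r_def)
  qed
  have "3 * card (pverts G) + (\<Sum>v\<in>pverts G. c v) = (\<Sum>v\<in>pverts G. 3 + c v)"
    by (simp add: sum.distrib)
  also have "\<dots> \<le> (\<Sum>v\<in>pverts G. 2 * f v + r v)"
    using cost by (rule sum_mono)
  also have "\<dots> = 2 * weight G f + (\<Sum>v\<in>pverts G. r v)"
    by (simp add: weight_def sum.distrib sum_distrib_left)
  finally show ?thesis
    using transfer \<open>D = 1\<close> by simp
qed

lemma rdR_lower_bound:
  assumes "\<And>v. v \<in> pverts G \<Longrightarrow> card (neighbours G v) \<le> D" and "1 \<le> D"
  shows "3 * card (pverts G) \<le> (D + 1) * \<gamma>_rdR G"
proof -
  \<comment> \<open>The least element is attained only if some RDRD-function exists.\<close>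
  have "RDRD_function G (\<lambda>_. 2)"
    by (rule RDRD_function_without_zero) simp_all
  then have "\<exists>w f. RDRD_function G f \<and> weight G f = w"
    by blast
  then have "\<exists>f. RDRD_function G f \<and> weight G f = \<gamma>_rdR G"
    unfolding \<gamma>_rdR_def by (rule LeastI_ex)
  then obtain f where "RDRD_function G f" "weight G f = \<gamma>_rdR G"
    by (elim exE conjE)
  then show ?thesis
    using RDRD_weight_lower_bound[OF _ assms, of f] by simp
qed

section \<open>The upper bound for connected graphs\<close>

text \<open>
  If the vertex \<open>a\<close> and its neighbours have at most one neighbour each, then \<open>a\<close> together with its
  neighbour is closed under adjacency, so by connectedness it is the whole graph.
\<close>

lemma connected_imp_two_neighbours:
  assumes conn: "Digraph_Component.connected (with_proj G)" and card: "3 \<le> card (pverts G)"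
  obtains v a b where "a \<in> neighbours G v" "b \<in> neighbours G v" "a \<noteq> b"
proof -
  have "\<exists>v a b. a \<in> neighbours G v \<and> b \<in> neighbours G v \<and> a \<noteq> b"
  proof (rule ccontr)
    assume "\<not> ?thesis"
    then have unique: "a = b" if "a \<in> neighbours G v" "b \<in> neighbours G v" for v a b
      using that by blast
    obtain a where a: "a \<in> pverts G"
      using card by fastforce
    have strong: "strongly_connected (with_proj G)"
      using symmetric_connected_imp_strongly_connected[OF pair_sym_arcs conn] .
    have "pverts G \<subseteq> insert a (neighbours G a)"
    proof
      fix x assume "x \<in> pverts G"
      then have "a \<rightarrow>\<^sup>*\<^bsub>with_proj G\<^esub> x"
        using strong a by (auto simp: strongly_connected_def)
      then show "x \<in> insert a (neighbours G a)"
      proof (induction rule: reachable_induct)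
        case (step x y)
        then have y: "y \<in> neighbours G x"
          by (simp add: neighbours_def)
        show ?case
        proof (cases "x = a")
          case False
          then have "a \<in> neighbours G x"
            using step.IH neighbours_sym by auto
          then show ?thesis
            using unique y by blast
        qed (use y in simp)
      qed simp
    qed
    then have "card (pverts G) \<le> card (insert a (neighbours G a))"
      using finite_neighbours by (intro card_mono) auto
    also have "\<dots> \<le> Suc (card (neighbours G a))"
      by (rule card_insert_le_m1) auto
    also have "card (neighbours G a) \<le> 1"
      using unique by (auto simp: card_le_Suc0_iff_eq finite_neighbours)
    finally show False
      using card by simp
  qed
  then show ?thesis using that by blast
qed

lemma connected_rdR_upper_bound:
  assumes "Digraph_Component.connected (with_proj G)" and "3 \<le> card (pverts G)"
  shows "\<gamma>_rdR G + 2 \<le> 2 * card (pverts G)"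
proof -
  obtain v a b where ab: "a \<in> neighbours G v" "b \<in> neighbours G v" "a \<noteq> b"
    using connected_imp_two_neighbours[OF assms] .
  have verts: "a \<in> pverts G" "b \<in> pverts G"
    using ab neighbours_subset by auto
  have v: "v \<noteq> a" "v \<noteq> b" "v \<in> neighbours G a" "v \<in> neighbours G b"
    using ab neighbours_sym by (auto simp: neighbours_def dest: no_loops')
  define f where "f x = (if x \<in> {a, b} then 1 else 2 :: nat)" for x
  have "RDRD_function G f"
  proof (rule RDRD_function_without_zero)
    fix x assume "f x = 1"
    then have "x = a \<or> x = b"
      by (simp add: f_def split: if_splits)
    then show "\<exists>u\<in>neighbours G x. 2 \<le> f u"
      using v by (auto simp: f_def intro!: bexI[of _ v])
  qed (simp add: f_def)
  then have le: "\<gamma>_rdR G \<le> weight G f"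
    unfolding \<gamma>_rdR_def by (intro Least_le) blast
  have "weight G f + 2 = (\<Sum>x\<in>pverts G. f x) + (\<Sum>x\<in>{a, b}. 1)"
    using ab by (simp add: weight_def)
  also have "(\<Sum>x\<in>{a, b}. 1) = (\<Sum>x\<in>pverts G. if x \<in> {a, b} then 1 else 0)"
    using verts pair_finite_verts by (intro sum.mono_neutral_cong_left) auto
  also have "(\<Sum>x\<in>pverts G. f x) + \<dots> = (\<Sum>x\<in>pverts G. 2)"
    unfolding sum.distrib[symmetric] by (rule sum.cong) (auto simp: f_def)
  finally show ?thesis
    using le by simp
qed

end

section \<open>Cardinal products\<close>

lemma pair_graph_cardinal_product:
  assumes "pair_graph G" and "pair_graph H"
  shows "pair_graph (cardinal_product G H)"
proof -
  interpret G: pair_graph G by fact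
  interpret H: pair_graph H by fact
  let ?P = "cardinal_product G H"
  have sub: "parcs ?P \<subseteq> pverts ?P \<times> pverts ?P"
    by (auto simp: cardinal_product_def
        dest: G.in_arcsD1 G.in_arcsD2 H.in_arcsD1 H.in_arcsD2)
  have fin: "finite (pverts ?P)"
    using G.pair_finite_verts H.pair_finite_verts by (simp add: cardinal_product_def)
  show ?thesis
  proof unfold_locales
    show "finite (parcs ?P)"
      using sub fin by (meson finite_SigmaI finite_subset)
    show "symmetric (with_proj ?P)"
      by (auto simp: symmetric_def cardinal_product_def
          intro!: symI G.arcs_symmetric H.arcs_symmetric)
    show "fst e \<noteq> snd e" if "e \<in> parcs ?P" for e
      using that by (auto simp: cardinal_product_def dest: G.no_loops')
  qed (use sub fin in auto)
qed

lemma neighbours_cardinal_product: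
  "neighbours (cardinal_product G H) (u, v) = neighbours G u \<times> neighbours H v"
  by (auto simp: neighbours_def cardinal_product_def)

theorem mainTheorem3:
  fixes G :: "'a pair_pre_digraph" and H :: "'b pair_pre_digraph" and n m :: nat
  assumes "pair_graph G" and "pair_graph H"
    and "card (pverts G) = n" and "card (pverts H) = m"
    and "parcs G \<noteq> {}" and "parcs H \<noteq> {}"
  shows "int (\<gamma>_rdR (cardinal_product G H))
           \<ge> \<lceil>3 * real n * real m / (real (max_degree G) * real (max_degree H) + 1)\<rceil>
       \<and> (Digraph_Component.connected (with_proj (cardinal_product G H)) \<longrightarrow>
            int (\<gamma>_rdR (cardinal_product G H)) \<le> 2 * int n * int m - 2)"
proof -
  let ?P = "cardinal_product G H"
  let ?D = "max_degree G * max_degree H"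
  interpret G: pair_graph G by fact
  interpret H: pair_graph H by fact
  interpret P: pair_graph ?P
    using assms(1,2) by (rule pair_graph_cardinal_product)
  have order: "card (pverts ?P) = n * m"
    using assms(3,4) by (simp add: cardinal_product_def card_cartesian_product)
  have "card (neighbours ?P p) \<le> ?D" if "p \<in> pverts ?P" for p
  proof (cases p)
    case (Pair u v)
    then have "u \<in> pverts G" "v \<in> pverts H"
      using that by (auto simp: cardinal_product_def)
    then show ?thesis
      unfolding Pair neighbours_cardinal_product card_cartesian_product
      by (intro mult_le_mono G.card_neighbours_le_max_degree H.card_neighbours_le_max_degree)
  qed
  moreover have "1 * 1 \<le> ?D"
    by (intro mult_le_mono G.max_degree_pos H.max_degree_pos assms(5,6))
  ultimately have "3 * (n * m) \<le> (?D + 1) * \<gamma>_rdR ?P"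
    unfolding order[symmetric] mult_1 by (rule P.rdR_lower_bound)
  then have "real (3 * (n * m)) \<le> real ((?D + 1) * \<gamma>_rdR ?P)"
    by (rule of_nat_mono)
  then have "3 * real n * real m \<le> real (\<gamma>_rdR ?P) * (real (max_degree G) * real (max_degree H) + 1)"
    by (simp add: algebra_simps)
  moreover have "0 < real (max_degree G) * real (max_degree H) + 1"
    by (simp add: add_nonneg_pos)
  ultimately have lower:
    "3 * real n * real m / (real (max_degree G) * real (max_degree H) + 1) \<le> real (\<gamma>_rdR ?P)"
    by (simp add: pos_divide_le_eq)
  have "2 * 2 \<le> n * m"
    using mult_le_mono[OF G.two_le_card_verts H.two_le_card_verts] assms(3-6) by simp
  then have "\<gamma>_rdR ?P + 2 \<le> 2 * (n * m)" if "Digraph_Component.connected (with_proj ?P)"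
    using P.connected_rdR_upper_bound[OF that] order by simp
  then have "int (\<gamma>_rdR ?P + 2) \<le> int (2 * (n * m))"
    if "Digraph_Component.connected (with_proj ?P)"
    using that by (intro of_nat_mono)
  then have upper: "int (\<gamma>_rdR ?P) \<le> 2 * int n * int m - 2"
    if "Digraph_Component.connected (with_proj ?P)"
    using that by simp
  from lower upper show ?thesis
    by (auto simp: ceiling_le_iff)
qed

end
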